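(* If a coordinate system $\boldsymbol x=(x_1,\dots,x_N):\mathbb R^N\supset U\to\mathbb R^N$ satisfies two conditions: (i) $\boldsymbol x(\boldsymbol s)$ factorizes, in the sense that $$x_k(\boldsymbol s)=f_1^k(s_1)f_2^k(s_2)\cdots f_N^k(s_N),\qquad k=1,\dots,N,$$ with all $f_i^k(s_i)\neq 0$ and $(f_i^k)'(s_i)\neq 0$; (ii) $\boldsymbol x$ is orthogonal, that is, $\langle\partial_i\boldsymbol x,\partial_j\boldsymbol x\rangle=0$ for $i\neq j$, then all coordinate hypersurfaces $s_i=\mathrm{const}$ ($i=1,\dots,N$) are confocal quadrics.
   Context: A coordinate system is a (smooth) map $\boldsymbol x:U\to\mathbb R^N$ on an open set $U\subset\mathbb R^N$ with $\det(\partial x_i/\partial s_j)_{i,j=1}^N\neq 0$; $\boldsymbol s=(s_1,\dots,s_N)$, $\partial_i=\partial/\partial s_i$, and $\langle\cdot,\cdot\rangle$ is the Euclidean scalar product. That the coordinate hypersurfaces are confocal quadrics means that for all $i=1,\dots,N$ and for any values of $s_i$ they lie on quadrics belonging to one and the same confocal family $\sum_{k=1}^N\frac{x_k^2}{\lambda+a_k}=1$, with parameter $\lambda$ and fixed real numbers $a_1,\dots,a_N$.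
   Formalization: U is assumed connected, and for each i the product ⟨x,∂_i x⟩ is assumed not identically zero on U (this also excludes empty U); without these, polar coordinates, or two boxes carrying different confocal families, are counterexamples. *)

theory Defs
  imports "HOL-Analysis.Analysis"
begin

text \<open>The index type \<open>'n\<close> plays the role of \<open>{1, \<dots>, N}\<close>, with \<open>N = CARD('n)\<close>.\<close>

text \<open>On an open set \<open>U\<close>, \<open>Ck_on k U f\<close> says that \<open>f\<close> is \<open>k\<close> times continuously differentiable.\<close>

primrec Ck_on ::
  "nat \<Rightarrow> 'a::real_normed_vector set \<Rightarrow> ('a \<Rightarrow> 'b::real_normed_vector) \<Rightarrow> bool" where
  "Ck_on 0 U f \<longleftrightarrow> continuous_on U f"
| "Ck_on (Suc k) U f \<longleftrightarrow>
     (\<forall>s\<in>U. f differentiable (at s)) \<and>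
     (\<forall>v. Ck_on k U (\<lambda>s. frechet_derivative f (at s) v))"

definition smooth_map_on ::
  "'a::real_normed_vector set \<Rightarrow> ('a \<Rightarrow> 'b::real_normed_vector) \<Rightarrow> bool" where
  "smooth_map_on U f \<longleftrightarrow> (\<forall>k. Ck_on k U f)"

definition coord_deriv :: "'n::finite \<Rightarrow> (real^'n \<Rightarrow> real^'n) \<Rightarrow> real^'n \<Rightarrow> real^'n" where
  "coord_deriv i x s = frechet_derivative x (at s) (axis i 1)"

definition coordinate_system :: "(real^'n::finite) set \<Rightarrow> (real^'n \<Rightarrow> real^'n) \<Rightarrow> bool" where
  "coordinate_system U x \<longleftrightarrow>
     open U \<and> smooth_map_on U x \<and>
     (\<forall>s\<in>U. det (jacobian x (at s)) \<noteq> 0)"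

definition orthogonal_system :: "(real^'n::finite) set \<Rightarrow> (real^'n \<Rightarrow> real^'n) \<Rightarrow> bool" where
  "orthogonal_system U x \<longleftrightarrow>
     (\<forall>s\<in>U. \<forall>i j. i \<noteq> j \<longrightarrow> coord_deriv i x s \<bullet> coord_deriv j x s = 0)"

text \<open>The factor \<open>f i k\<close> is only constrained on the values that the coordinate \<open>s\<^sub>i\<close> takes
  on \<open>U\<close>.\<close>

definition factorizes_on ::
  "(real^'n::finite) set \<Rightarrow> (real^'n \<Rightarrow> real^'n) \<Rightarrow> ('n \<Rightarrow> 'n \<Rightarrow> real \<Rightarrow> real) \<Rightarrow> bool" where
  "factorizes_on U x f \<longleftrightarrow>
     (\<forall>s\<in>U. \<forall>k. x s $ k = (\<Prod>i\<in>UNIV. f i k (s $ i))) \<and>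
     (\<forall>i k. \<forall>t \<in> (\<lambda>s. s $ i) ` U.
        f i k t \<noteq> 0 \<and> f i k differentiable (at t) \<and> deriv (f i k) t \<noteq> 0)"

definition coordinate_hypersurface ::
  "(real^'n::finite) set \<Rightarrow> (real^'n \<Rightarrow> real^'n) \<Rightarrow> 'n \<Rightarrow> real \<Rightarrow> (real^'n) set" where
  "coordinate_hypersurface U x i c = x ` {s \<in> U. s $ i = c}"

definition confocal_quadric :: "real^'n::finite \<Rightarrow> real \<Rightarrow> (real^'n) set" where
  "confocal_quadric a l = {p. (\<Sum>k\<in>UNIV. (p $ k)\<^sup>2 / (l + a $ k)) = 1}"

text \<open>The parameter value must avoid the poles \<open>- a\<^sub>k\<close>: there the total division of HOL would
  silently drop a term, and the set above would no longer be a member of the family.\<close>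

definition coordinate_hypersurfaces_confocal ::
  "(real^'n::finite) set \<Rightarrow> (real^'n \<Rightarrow> real^'n) \<Rightarrow> bool" where
  "coordinate_hypersurfaces_confocal U x \<longleftrightarrow>
     (\<exists>a::real^'n. \<forall>i c. \<exists>l.
        (\<forall>k. l + a $ k \<noteq> 0) \<and>
        coordinate_hypersurface U x i c \<subseteq> confocal_quadric a l)"

text \<open>Excludes systems in which, for some \<open>i\<close>, the norm of \<open>x\<close> does not depend on \<open>s\<^sub>i\<close>.
  Then the hypersurfaces \<open>s\<^sub>i = const\<close> of an orthogonal system are (pieces of) cones with apex
  at the origin, which lie on no quadric \<open>confocal_quadric a l\<close>. Polar coordinates
  \<open>(r cos \<phi>, r sin \<phi>)\<close> with \<open>0 < \<phi> < pi / 2\<close> and, in dimension 3, sphero-conical coordinates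
  are factorizing orthogonal systems of this kind.\<close>

definition nonconical :: "(real^'n::finite) set \<Rightarrow> (real^'n \<Rightarrow> real^'n) \<Rightarrow> bool" where
  "nonconical U x \<longleftrightarrow> (\<forall>i. \<exists>s\<in>U. x s \<bullet> coord_deriv i x s \<noteq> 0)"

end

theory Submission
  imports Defs
begin

text \<open>
  Everything rests on the squares \<open>g\<^sub>i\<^sup>k = (f\<^sub>i\<^sup>k)\<^sup>2\<close>, because
  \<open>x\<^sub>k\<^sup>2 = \<Prod>\<^sub>i g\<^sub>i\<^sup>k(s\<^sub>i)\<close> and, for \<open>i \<noteq> j\<close>, the product
  \<open>4 \<langle>\<partial>\<^sub>i x, \<partial>\<^sub>j x\<rangle>\<close> is the mixed derivative \<open>\<partial>\<^sub>i \<partial>\<^sub>j\<close> of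
  \<open>\<Sum>\<^sub>k x\<^sub>k\<^sup>2\<close>.

  \<^emph>\<open>Straightening.\<close> Move a point in the single coordinate \<open>s\<^sub>i\<close>. Orthogonality at the new
  point says that the vector \<open>((g\<^sub>i\<^sup>k)')\<^sub>k\<close>, rescaled componentwise by factors that depend
  only on the old point, is orthogonal to all \<open>\<partial>\<^sub>j x\<close> with \<open>j \<noteq> i\<close> at the old point. Since
  the \<open>\<partial>\<^sub>j x\<close> form an orthogonal basis, it is a multiple of \<open>\<partial>\<^sub>i x\<close>. Hence the direction of
  \<open>((g\<^sub>i\<^sup>k)')\<^sub>k\<close> is locally constant, and it is constant because the range of the coordinate
  is an interval: \<open>(g\<^sub>i\<^sup>k)' = \<alpha>\<^sub>i\<^sup>k h\<^sub>i\<close> (\<open>sq_deriv_splits\<close>). After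
  reparametrization of each coordinate the \<open>x\<^sub>k\<^sup>2\<close> are products of affine functions.

  \<^emph>\<open>Moments.\<close> Put \<open>w\<^sub>i\<^sup>k = \<alpha>\<^sub>i\<^sup>k / g\<^sub>i\<^sup>k\<close> and
  \<open>P\<^sub>S = \<Sum>\<^sub>k x\<^sub>k\<^sup>2 \<Prod>\<^bsub>l \<in> S\<^esub> w\<^sub>l\<^sup>k\<close>. Then
  \<open>\<partial>\<^sub>l P\<^sub>S = h\<^sub>l P\<^bsub>S \<union> {l}\<^esub>\<close> for \<open>l \<notin> S\<close>, and \<open>\<partial>\<^sub>l P\<^sub>S = 0\<close> for
  \<open>l \<in> S\<close>. Orthogonality is \<open>P\<^bsub>{i, j}\<^esub> = 0\<close>. By differentiation \<open>P\<^bsub>{i, j, l}\<^esub> = 0\<close>,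
  and \<open>P\<^bsub>{i}\<^esub>\<close> is a constant \<open>c\<^sub>i\<close> on the connected set \<open>U\<close>; it is nonzero
  because \<open>\<langle>x, \<partial>\<^sub>i x\<rangle> = h\<^sub>i c\<^sub>i / 2\<close> and the system is
  not conical.

  \<^emph>\<open>Quadrics.\<close> With \<open>y\<^sub>i\<^sup>k = c\<^sub>i / w\<^sub>i\<^sup>k\<close>, a function of \<open>s\<^sub>i\<close> alone, the identity
  \<open>P\<^bsub>{i}\<^esub> = c\<^sub>i\<close> reads \<open>\<Sum>\<^sub>k x\<^sub>k\<^sup>2 / y\<^sub>i\<^sup>k = 1\<close>, so each hypersurface lies on a quadric.

  \<^emph>\<open>Confocality.\<close> It remains to write \<open>y\<^sub>i\<^sup>k = \<lambda>\<^sub>i(s\<^sub>i) + a\<^sub>k\<close>, that is, to see that all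
  the differences between the vectors \<open>(y\<^sub>i\<^sup>k)\<^sub>k\<close>, for varying \<open>i\<close> and \<open>s\<close>, are independent
  of \<open>k\<close>. For fixed \<open>i\<close> this is the straightening (\<open>denom_diff_same_index\<close>). For fixed \<open>s\<close>
  (\<open>denom_diff_same_point\<close>) note that \<open>(x\<^sub>k w\<^sub>l\<^sup>k)\<^sub>k\<close> is a multiple of \<open>\<partial>\<^sub>l x\<close>. The
  vanishing of \<open>P\<^bsub>{i, j, l}\<^esub>\<close> puts \<open>w\<^sub>i w\<^sub>j\<close> into the span of \<open>w\<^sub>i\<close> and \<open>w\<^sub>j\<close>, and
  \<open>P\<^bsub>{i, j}\<^esub> = 0\<close> fixes the ratio of the coefficients:
  \<open>w\<^sub>i w\<^sub>j = \<kappa> (c\<^sub>i w\<^sub>j - c\<^sub>j w\<^sub>i)\<close>. Division by \<open>w\<^sub>i w\<^sub>j\<close> gives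
  \<open>y\<^sub>i\<^sup>k - y\<^sub>j\<^sup>k = 1 / \<kappa>\<close>.
\<close>

section \<open>Linear algebra of an orthogonal frame\<close>

lemma orthogonal_frame_expansion:
  fixes A :: "real^'n^'n"
  assumes nonsingular: "det A \<noteq> 0"
    and orth: "\<And>i j. i \<noteq> j \<Longrightarrow> column i A \<bullet> column j A = 0"
    and perp: "\<And>l. l \<notin> S \<Longrightarrow> v \<bullet> column l A = 0"
  shows "v = (\<Sum>j\<in>S. (v \<bullet> column j A / (column j A \<bullet> column j A)) *\<^sub>R column j A)"
    (is "v = ?p")
proof -
  have col_nz: "column j A \<noteq> 0" for j
    using nonsingular det_zero_column by (metis zero_index vec_eq_iff)
  have fin: "finite S" by simp
  have "(v - ?p) \<bullet> column l A = 0" for l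
  proof -
    have "?p \<bullet> column l A
        = (\<Sum>j\<in>S. (v \<bullet> column j A / (column j A \<bullet> column j A)) * (column j A \<bullet> column l A))"
      by (simp add: inner_sum_left)
    also have "\<dots> = (\<Sum>j\<in>S. if j = l then v \<bullet> column l A else 0)"
      by (rule sum.cong) (use orth col_nz in auto)
    also have "\<dots> = v \<bullet> column l A"
      using perp[of l] fin by auto
    finally show ?thesis by (simp add: inner_diff_left)
  qed
  then have "transpose A *v (v - ?p) = 0"
    by (simp add: vec_eq_iff matrix_vector_mult_def transpose_def inner_vec_def column_def
        mult.commute)
  moreover have "\<exists>B. B ** transpose A = mat 1"
    using nonsingular invertible_det_nz[of "transpose A"] by (auto simp: invertible_def)
  ultimately have "v - ?p = 0"
    unfolding matrix_left_invertible_ker by blast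
  then show ?thesis by simp
qed

lemma has_derivative_coord:
  fixes s :: "real^'n"
  assumes "(g has_real_derivative D) (at (s $ i))"
  shows "((\<lambda>s. g (s $ i)) has_derivative (\<lambda>v. D * v $ i)) (at s)"
proof -
  have "((\<lambda>s::real^'n. s $ i) has_derivative (\<lambda>v. v $ i)) (at s)"
    by (simp add: bounded_linear_imp_has_derivative bounded_linear_vec_nth)
  from DERIV_compose_FDERIV[OF assms this] show ?thesis by (simp add: mult.commute)
qed

section \<open>Orthogonal systems in factorized form\<close>

locale factorized_orthogonal_system =
  fixes U :: "(real^'n::finite) set"
    and x :: "real^'n \<Rightarrow> real^'n"
    and f :: "'n \<Rightarrow> 'n \<Rightarrow> real \<Rightarrow> real"
  assumes system: "coordinate_system U x"
    and connected_U: "connected U"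
    and nonempty_U: "U \<noteq> {}"
    and factorizes: "factorizes_on U x f"
    and orthogonal: "orthogonal_system U x"
begin

abbreviation coord_range :: "'n \<Rightarrow> real set" where
  "coord_range i \<equiv> (\<lambda>s. s $ i) ` U"

lemma open_U: "open U"
  using system by (simp add: coordinate_system_def)

lemma x_eq_prod: "s \<in> U \<Longrightarrow> x s $ k = (\<Prod>i\<in>UNIV. f i k (s $ i))"
  using factorizes by (simp add: factorizes_on_def)

lemma factor_props:
  assumes "t \<in> coord_range i"
  shows factor_nonzero: "f i k t \<noteq> 0"
    and factor_deriv: "(f i k has_real_derivative deriv (f i k) t) (at t)"
    and factor_deriv_nonzero: "deriv (f i k) t \<noteq> 0"
  using factorizes assms unfolding factorizes_on_def
  by (auto simp: DERIV_deriv_iff_real_differentiable)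

lemma x_nonzero: "s \<in> U \<Longrightarrow> x s $ k \<noteq> 0"
  by (simp add: x_eq_prod factor_nonzero)

lemma open_coord_range: "open (coord_range i)"
  by (rule open_image_vec_nth[OF open_U])

lemma connected_coord_range: "connected (coord_range i)"
  by (intro connected_continuous_image continuous_intros connected_U)

text \<open>The tangent vectors are written with logarithmic derivatives of the factors: apart from the
  common factor \<open>x\<^sub>k\<close>, the \<open>k\<close>-th component of \<open>\<partial>\<^sub>i x\<close> depends on \<open>s\<^sub>i\<close> only.\<close>

lemma coord_deriv_eq:
  assumes "s \<in> U"
  shows "coord_deriv i x s $ k = x s $ k * (deriv (f i k) (s $ i) / f i k (s $ i))"
proof -
  let ?D = "\<lambda>v. \<chi> k. \<Sum>i\<in>UNIV. deriv (f i k) (s $ i) * v $ i * (\<Prod>j\<in>UNIV - {i}. f j k (s $ j))"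
  have factor: "((\<lambda>s. f i k (s $ i)) has_derivative (\<lambda>v. deriv (f i k) (s $ i) * v $ i)) (at s)"
    for i k
    by (rule has_derivative_coord) (simp add: factor_deriv assms)
  have prod: "((\<lambda>s. \<Prod>i\<in>UNIV. f i k (s $ i)) has_derivative (\<lambda>v. ?D v $ k)) (at s)" for k
    using has_derivative_prod[of UNIV "\<lambda>i s. f i k (s $ i)", OF factor] by simp
  have "((\<lambda>s. x s $ k) has_derivative (\<lambda>v. ?D v $ k)) (at s)" for k
    by (rule has_derivative_transform_within_open[OF prod open_U assms]) (simp add: x_eq_prod)
  then have "(x has_derivative ?D) (at s)"
    by (subst has_derivative_componentwise_within)
       (auto simp: Basis_vec_def inner_axis)
  then have "coord_deriv i x s = ?D (axis i 1)"
    unfolding coord_deriv_def by (simp only: frechet_derivative_at[symmetric])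
  also have "?D (axis i 1) $ k
      = (\<Sum>j\<in>UNIV. if j = i then deriv (f i k) (s $ i) * (\<Prod>j\<in>UNIV - {i}. f j k (s $ j)) else 0)"
    by (simp only: vec_lambda_beta) (rule sum.cong, auto simp: axis_def)
  also have "\<dots> = deriv (f i k) (s $ i) * (\<Prod>j\<in>UNIV - {i}. f j k (s $ j))"
    by simp
  also have "\<dots> = x s $ k * (deriv (f i k) (s $ i) / f i k (s $ i))"
    using assms by (simp add: x_eq_prod prod.remove[of UNIV i] factor_nonzero)
  finally show ?thesis .
qed

lemma coord_deriv_orthogonal:
  "s \<in> U \<Longrightarrow> i \<noteq> j \<Longrightarrow> coord_deriv i x s \<bullet> coord_deriv j x s = 0"
  using orthogonal by (simp add: orthogonal_system_def)

text \<open>The only way in which the nondegeneracy of the Jacobian enters: to locate a vector in the span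
  of a few tangent vectors, it suffices to test it against the others.\<close>

lemma coord_frame_expansion:
  assumes "s \<in> U" and "\<And>l. l \<notin> S \<Longrightarrow> v \<bullet> coord_deriv l x s = 0"
  obtains c where "v = (\<Sum>j\<in>S. c j *\<^sub>R coord_deriv j x s)"
proof -
  have col: "column j (jacobian x (at s)) = coord_deriv j x s" for j
    by (simp add: jacobian_def coord_deriv_def column_def matrix_def vec_eq_iff)
  have "v = (\<Sum>j\<in>S. (v \<bullet> column j (jacobian x (at s))
      / (column j (jacobian x (at s)) \<bullet> column j (jacobian x (at s)))) *\<^sub>R column j (jacobian x (at s)))"
  proof (rule orthogonal_frame_expansion)
    show "det (jacobian x (at s)) \<noteq> 0"
      using system assms(1) by (simp add: coordinate_system_def)
  qed (simp_all only: col coord_deriv_orthogonal[OF assms(1)] assms(2) not_False_eq_True)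
  then show ?thesis using that by (simp only: col)
qed

section \<open>Straightening the squared factors\<close>

definition sq_deriv :: "'n \<Rightarrow> 'n \<Rightarrow> real \<Rightarrow> real" where
  "sq_deriv i k t = 2 * f i k t * deriv (f i k) t"

lemma has_sq_deriv:
  "t \<in> coord_range i \<Longrightarrow> ((\<lambda>t. (f i k t)\<^sup>2) has_real_derivative sq_deriv i k t) (at t)"
  using DERIV_power[OF factor_deriv, of t i k 2] by (simp add: sq_deriv_def ac_simps)

lemma sq_deriv_nonzero: "t \<in> coord_range i \<Longrightarrow> sq_deriv i k t \<noteq> 0"
  by (simp add: sq_deriv_def factor_nonzero factor_deriv_nonzero)

definition replace_coord :: "real^'n \<Rightarrow> 'n \<Rightarrow> real \<Rightarrow> real^'n" where
  "replace_coord s i t = (\<chi> j. if j = i then t else s $ j)"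

lemma replace_coord_nth [simp]:
  "replace_coord s i t $ j = (if j = i then t else s $ j)"
  by (simp add: replace_coord_def)

text \<open>Comparing the orthogonality relations at two points that differ only in the \<open>i\<close>-th coordinate:
  the one-dimensional orthogonal complement of the tangent vectors \<open>\<partial>\<^sub>j x\<close>, \<open>j \<noteq> i\<close>, at the
  first point determines the direction of the derivative vector at the second.\<close>

lemma sq_deriv_direction_fixed:
  assumes s: "s \<in> U" and s': "replace_coord s i t \<in> U"
  obtains c where "\<And>k. sq_deriv i k t = c * sq_deriv i k (s $ i)"
proof -
  let ?s' = "replace_coord s i t"
  \<comment> \<open>Chosen so that its product with \<open>\<partial>\<^sub>j x(s)\<close> is a multiple of
    \<open>\<langle>\<partial>\<^sub>i x, \<partial>\<^sub>j x\<rangle>\<close> at the moved point; at \<open>t = s\<^sub>i\<close> it is \<open>2 \<partial>\<^sub>i x(s)\<close>.\<close>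
  define v :: "real^'n" where "v = (\<chi> k. sq_deriv i k t * x s $ k / (f i k (s $ i))\<^sup>2)"
  have ti: "t \<in> coord_range i" using s' by (rule rev_image_eqI) simp
  have x': "x ?s' $ k = x s $ k * f i k t / f i k (s $ i)" for k
  proof -
    have "(\<Prod>j\<in>UNIV - {i}. f j k (?s' $ j)) = (\<Prod>j\<in>UNIV - {i}. f j k (s $ j))"
      by (rule prod.cong) auto
    then show ?thesis
      using s s' by (simp add: x_eq_prod prod.remove[of UNIV i] factor_nonzero)
  qed
  have "v \<bullet> coord_deriv j x s = 0" if "j \<notin> {i}" for j
  proof -
    have ji: "j \<noteq> i" using that by simp
    have "2 * (coord_deriv i x ?s' \<bullet> coord_deriv j x ?s') = v \<bullet> coord_deriv j x s"
      unfolding inner_vec_def sum_distrib_left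
      by (rule sum.cong)
        (use s s' ti ji in \<open>simp_all add: v_def coord_deriv_eq x' sq_deriv_def factor_nonzero
          field_simps power2_eq_square\<close>)
    then show ?thesis using coord_deriv_orthogonal[OF s', of i j] ji by simp
  qed
  from coord_frame_expansion[OF s this] obtain c where
    c: "v = (\<Sum>j\<in>{i}. c j *\<^sub>R coord_deriv j x s)" by metis
  have "sq_deriv i k t = c i / 2 * sq_deriv i k (s $ i)" for k
  proof -
    have "v $ k = c i * coord_deriv i x s $ k" by (subst c) simp
    then show ?thesis
      using s x_nonzero[OF s, of k]
      by (simp add: v_def coord_deriv_eq sq_deriv_def factor_nonzero field_simps power2_eq_square)
  qed
  then show ?thesis using that by blast
qed

text \<open>Direction fixed near each point of \<open>U\<close> means ratio locally constant on the coordinate range.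
  Different parts of the range may be reached through different points of \<open>U\<close>; connectedness of
  \<open>U\<close> joins them.\<close>

lemma sq_deriv_ratio_constant:
  assumes "t \<in> coord_range i" "t' \<in> coord_range i"
  shows "sq_deriv i k t / sq_deriv i m t = sq_deriv i k t' / sq_deriv i m t'"
proof -
  let ?r = "\<lambda>t. sq_deriv i k t / sq_deriv i m t"
  have "?r constant_on coord_range i"
  proof (rule locally_constant_imp_constant[OF connected_coord_range])
    fix a assume "a \<in> coord_range i"
    then obtain s where s: "s \<in> U" and a: "a = s $ i" by (rule imageE)
    define T where "T = (\<lambda>t. replace_coord s i t) -` U"
    have cont: "continuous_on UNIV (\<lambda>t. replace_coord s i t)"
      unfolding replace_coord_def
    proof (rule continuous_on_vec_lambda)
      show "continuous_on UNIV (\<lambda>t. if j = i then t else s $ j)" for j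
        by (cases "j = i") simp_all
    qed
    have "open T"
      unfolding T_def by (rule open_vimage[OF open_U cont])
    moreover have sub: "T \<subseteq> coord_range i"
    proof
      fix t assume "t \<in> T"
      then have "replace_coord s i t \<in> U" by (simp add: T_def)
      then show "t \<in> coord_range i" by (rule rev_image_eqI) simp
    qed
    moreover have "a \<in> T"
    proof -
      have "replace_coord s i a = s" by (simp add: vec_eq_iff a)
      then show ?thesis using s by (simp add: T_def)
    qed
    moreover have "?r t = ?r a" if t: "t \<in> T" for t
    proof -
      have "replace_coord s i t \<in> U" using t by (simp add: T_def)
      from sq_deriv_direction_fixed[OF s this]
      obtain c where c: "\<And>k. sq_deriv i k t = c * sq_deriv i k a"
        unfolding a by blast
      moreover have "c \<noteq> 0"
        using c[of k] sq_deriv_nonzero[of t i k] t sub by auto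
      ultimately show ?thesis by simp
    qed
    ultimately show "\<exists>T. openin (top_of_set (coord_range i)) T \<and> a \<in> T \<and> (\<forall>t\<in>T. ?r t = ?r a)"
      by (blast intro: open_subset)
  qed
  then show ?thesis using assms by (auto simp: constant_on_def)
qed

text \<open>Separation of the component index from the parameter. The witness \<open>\<alpha> i k\<close> is the value of the
  derivative at a base point, and \<open>h i\<close> is the growth relative to the base point of a reference
  component \<open>m\<close>.\<close>

lemma sq_deriv_splits:
  obtains \<alpha> :: "'n \<Rightarrow> 'n \<Rightarrow> real" and h :: "'n \<Rightarrow> real \<Rightarrow> real"
  where "\<And>i k. \<alpha> i k \<noteq> 0" and "\<And>i t. t \<in> coord_range i \<Longrightarrow> h i t \<noteq> 0"
    and "\<And>i k t. t \<in> coord_range i \<Longrightarrow> sq_deriv i k t = \<alpha> i k * h i t"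
proof -
  obtain s0 where s0: "s0 \<in> U" using nonempty_U by blast
  obtain m :: 'n where True by simp
  let ?\<alpha> = "\<lambda>i k. sq_deriv i k (s0 $ i)" and ?h = "\<lambda>i t. sq_deriv i m t / sq_deriv i m (s0 $ i)"
  show ?thesis
  proof (rule that[of ?\<alpha> ?h])
    show "?\<alpha> i k \<noteq> 0" for i k using s0 by (simp add: sq_deriv_nonzero)
    show "?h i t \<noteq> 0" if "t \<in> coord_range i" for i t
      using s0 that by (simp add: sq_deriv_nonzero)
    show "sq_deriv i k t = ?\<alpha> i k * ?h i t" if "t \<in> coord_range i" for i k t
      using sq_deriv_ratio_constant[OF that, of "s0 $ i" k m] s0 that
      by (simp add: sq_deriv_nonzero field_simps)
  qed
qed

end

section \<open>Moments of the straightened system\<close>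

locale straightened_system = factorized_orthogonal_system U x f
  for U :: "(real^'n::finite) set" and x f +
  fixes \<alpha> :: "'n \<Rightarrow> 'n \<Rightarrow> real" and h :: "'n \<Rightarrow> real \<Rightarrow> real"
  assumes slope_nonzero: "\<alpha> i k \<noteq> 0"
    and speed_nonzero: "t \<in> coord_range i \<Longrightarrow> h i t \<noteq> 0"
    and sq_deriv_eq: "t \<in> coord_range i \<Longrightarrow> sq_deriv i k t = \<alpha> i k * h i t"
begin

text \<open>\<open>h i * weight i k\<close> is the logarithmic derivative of the squared factor \<open>(f i k)\<^sup>2\<close>. In terms
  of weights, \<open>moment S\<close> is \<open>\<Sum>\<^sub>k x\<^sub>k\<^sup>2 \<Prod>\<^bsub>l \<in> S\<^esub> weight l k\<close> on \<open>U\<close> (\<open>moment_eq\<close>). The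
  definition uses the product form, in which the coordinates with index in \<open>S\<close> do not
  appear.\<close>

definition weight :: "'n \<Rightarrow> 'n \<Rightarrow> real \<Rightarrow> real" where
  "weight i k t = \<alpha> i k / (f i k t)\<^sup>2"

definition moment :: "'n set \<Rightarrow> real^'n \<Rightarrow> real" where
  "moment S s = (\<Sum>k\<in>UNIV. (\<Prod>l\<in>S. \<alpha> l k) * (\<Prod>l\<in>-S. (f l k (s $ l))\<^sup>2))"

lemma weight_nonzero: "t \<in> coord_range i \<Longrightarrow> weight i k t \<noteq> 0"
  by (simp add: weight_def slope_nonzero factor_nonzero)

lemma moment_eq:
  assumes "s \<in> U"
  shows "moment S s = (\<Sum>k\<in>UNIV. (x s $ k)\<^sup>2 * (\<Prod>l\<in>S. weight l k (s $ l)))"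
  unfolding moment_def
proof (rule sum.cong[OF refl])
  fix k
  let ?g = "\<lambda>l. (f l k (s $ l))\<^sup>2"
  have "(\<Prod>l\<in>S. weight l k (s $ l)) = (\<Prod>l\<in>S. \<alpha> l k) / (\<Prod>l\<in>S. ?g l)"
    by (simp add: weight_def prod_dividef)
  moreover have "(x s $ k)\<^sup>2 = (\<Prod>l\<in>UNIV. ?g l)"
    using assms by (simp add: x_eq_prod prod_power_distrib)
  moreover have "(\<Prod>l\<in>UNIV. ?g l) = (\<Prod>l\<in>S. ?g l) * (\<Prod>l\<in>-S. ?g l)"
    using prod.subset_diff[of S UNIV ?g] by (simp add: Compl_eq_Diff_UNIV mult.commute)
  moreover have "(\<Prod>l\<in>S. ?g l) \<noteq> 0"
    using assms by (simp add: factor_nonzero)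
  ultimately show "(\<Prod>l\<in>S. \<alpha> l k) * (\<Prod>l\<in>-S. ?g l) = (x s $ k)\<^sup>2 * (\<Prod>l\<in>S. weight l k (s $ l))"
    by simp
qed

text \<open>Differentiating in the direction \<open>l \<notin> S\<close> replaces the squared factor of index \<open>l\<close> by its
  derivative \<open>\<alpha> l k * h l\<close>, so it merely moves \<open>l\<close> into the index set. This closes the family of
  moments under differentiation.\<close>

lemma has_derivative_moment:
  assumes "s \<in> U"
  shows "(moment S has_derivative
    (\<lambda>v. \<Sum>l\<in>-S. h l (s $ l) * v $ l * moment (insert l S) s)) (at s)"
proof -
  have sq: "((\<lambda>s. (f l k (s $ l))\<^sup>2) has_derivative (\<lambda>v. \<alpha> l k * h l (s $ l) * v $ l)) (at s)" for l k
    by (rule has_derivative_coord) (use has_sq_deriv[of "s $ l" l k] assms in \<open>simp add: sq_deriv_eq\<close>)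
  have "(moment S has_derivative (\<lambda>v. \<Sum>k\<in>UNIV. (\<Prod>l\<in>S. \<alpha> l k) *
      (\<Sum>l\<in>-S. \<alpha> l k * h l (s $ l) * v $ l * (\<Prod>j\<in>-S - {l}. (f j k (s $ j))\<^sup>2)))) (at s)"
    unfolding moment_def[abs_def]
    by (intro has_derivative_sum has_derivative_mult_right has_derivative_prod sq)
  moreover have "(\<Sum>k\<in>UNIV. (\<Prod>l\<in>S. \<alpha> l k) *
      (\<Sum>l\<in>-S. \<alpha> l k * h l (s $ l) * v $ l * (\<Prod>j\<in>-S - {l}. (f j k (s $ j))\<^sup>2)))
    = (\<Sum>l\<in>-S. h l (s $ l) * v $ l * moment (insert l S) s)" for v :: "real^'n"
  proof -
    have "(\<Sum>k\<in>UNIV. (\<Prod>l\<in>S. \<alpha> l k) *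
        (\<Sum>l\<in>-S. \<alpha> l k * h l (s $ l) * v $ l * (\<Prod>j\<in>-S - {l}. (f j k (s $ j))\<^sup>2)))
      = (\<Sum>l\<in>-S. \<Sum>k\<in>UNIV. (\<Prod>l\<in>S. \<alpha> l k) *
        (\<alpha> l k * h l (s $ l) * v $ l * (\<Prod>j\<in>-S - {l}. (f j k (s $ j))\<^sup>2)))"
      unfolding sum_distrib_left by (rule sum.swap)
    also have "\<dots> = (\<Sum>l\<in>-S. h l (s $ l) * v $ l * moment (insert l S) s)"
    proof (rule sum.cong[OF refl])
      fix l assume l: "l \<in> -S"
      have "- insert l S = -S - {l}" by auto
      then show "(\<Sum>k\<in>UNIV. (\<Prod>l\<in>S. \<alpha> l k) *
          (\<alpha> l k * h l (s $ l) * v $ l * (\<Prod>j\<in>-S - {l}. (f j k (s $ j))\<^sup>2)))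
        = h l (s $ l) * v $ l * moment (insert l S) s"
        using l by (simp add: moment_def sum_distrib_left algebra_simps)
    qed
    finally show ?thesis .
  qed
  ultimately show ?thesis by simp
qed

lemma coord_deriv_eq_weight:
  assumes "s \<in> U"
  shows "coord_deriv i x s $ k = h i (s $ i) / 2 * (x s $ k * weight i k (s $ i))"
  using sq_deriv_eq[of "s $ i" i k] assms
  by (simp add: coord_deriv_eq weight_def sq_deriv_def factor_nonzero field_simps power2_eq_square)

lemma moment_pair_zero:
  assumes s: "s \<in> U" and ij: "i \<noteq> j"
  shows "moment {i, j} s = 0"
proof -
  have "coord_deriv i x s \<bullet> coord_deriv j x s = h i (s $ i) / 2 * (h j (s $ j) / 2) * moment {i, j} s"
    using ij unfolding moment_eq[OF s] inner_vec_def sum_distrib_left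
    by (intro sum.cong) (simp_all add: coord_deriv_eq_weight[OF s] power2_eq_square)
  then show ?thesis
    using coord_deriv_orthogonal[OF s ij] speed_nonzero s by simp
qed

text \<open>Apart from the nonzero factor \<open>h l\<close>, this is the \<open>l\<close>-derivative of the orthogonality
  relation.\<close>

lemma moment_triple_zero:
  assumes s: "s \<in> U" and ne: "i \<noteq> j" "l \<noteq> i" "l \<noteq> j"
  shows "moment {l, i, j} s = 0"
proof -
  let ?D = "\<lambda>v. \<Sum>m\<in>-{i, j}. h m (s $ m) * v $ m * moment (insert m {i, j}) s"
  have "((\<lambda>_. 0) has_derivative ?D) (at s)"
    by (rule has_derivative_transform_within_open[OF has_derivative_moment[OF s] open_U s])
      (rule moment_pair_zero[OF _ ne(1)])
  then have "?D = (\<lambda>_. 0)"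
    by (rule has_derivative_unique[OF _ has_derivative_const])
  then have "?D (axis l 1) = 0" by (rule fun_cong)
  moreover have "?D (axis l 1)
      = (\<Sum>m\<in>-{i, j}. if m = l then h l (s $ l) * moment {l, i, j} s else 0)"
    by (rule sum.cong) (auto simp: axis_def)
  ultimately show ?thesis
    using ne s speed_nonzero[of "s $ l" l] by simp
qed

text \<open>Every partial derivative vanishes: the one along \<open>i\<close> because \<open>s\<^sub>i\<close> does not occur, the
  others because they are multiples of moments of pairs.\<close>

lemma moment_single_constant:
  assumes "s \<in> U" "s' \<in> U"
  shows "moment {i} s = moment {i} s'"
proof (rule has_derivative_zero_unique_connected[OF open_U connected_U _ assms])
  fix s assume s: "s \<in> U"
  have "moment {l, i} s = 0" if "l \<in> -{i}" for l
    using moment_pair_zero[OF s, of l i] that by simp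
  then show "(moment {i} has_derivative (\<lambda>v. 0)) (at s)"
    using has_derivative_moment[OF s, of "{i}"] by simp
qed

lemma moment_single_nonzero:
  assumes "nonconical U x" "s \<in> U"
  shows "moment {i} s \<noteq> 0"
proof -
  obtain s' where s': "s' \<in> U" and ne: "x s' \<bullet> coord_deriv i x s' \<noteq> 0"
    using assms(1) by (auto simp: nonconical_def)
  have "x s' \<bullet> coord_deriv i x s' = h i (s' $ i) / 2 * moment {i} s'"
    unfolding moment_eq[OF s'] inner_vec_def sum_distrib_left
    by (intro sum.cong) (simp_all add: coord_deriv_eq_weight[OF s'] power2_eq_square)
  then show ?thesis using ne moment_single_constant[OF s' assms(2), of i] by auto
qed

section \<open>The denominators of the confocal family\<close>

text \<open>These numbers turn out to be the denominators \<open>\<lambda> + a\<^sub>k\<close> of the quadric that carries the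
  hypersurface of index \<open>i\<close> through \<open>x s\<close>. As the moment is constant, they depend on \<open>s\<close> through
  \<open>s $ i\<close> only.\<close>

definition denom :: "'n \<Rightarrow> 'n \<Rightarrow> real^'n \<Rightarrow> real" where
  "denom i k s = moment {i} s / weight i k (s $ i)"

lemma sum_squares_over_denom:
  assumes "nonconical U x" and s: "s \<in> U"
  shows "(\<Sum>k\<in>UNIV. (x s $ k)\<^sup>2 / denom i k s) = 1"
proof -
  have "(\<Sum>k\<in>UNIV. (x s $ k)\<^sup>2 / denom i k s)
      = (\<Sum>k\<in>UNIV. (x s $ k)\<^sup>2 * weight i k (s $ i)) / moment {i} s"
    by (simp add: denom_def sum_divide_distrib)
  also have "\<dots> = moment {i} s / moment {i} s"
    by (simp add: moment_eq[OF s])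
  finally have "(\<Sum>k\<in>UNIV. (x s $ k)\<^sup>2 / denom i k s) = moment {i} s / moment {i} s" .
  then show ?thesis using moment_single_nonzero[OF assms] by simp
qed

text \<open>The weights of index \<open>i\<close> and \<open>j\<close> satisfy one bilinear relation with coefficients that do not
  depend on the component. It expresses that their product, as a vector, lies in the plane which they
  span and is orthogonal there to the vector of ones with respect to the inner product weighted by
  \<open>x\<^sub>k\<^sup>2\<close>.\<close>

lemma denom_diff_same_point:
  assumes nc: "nonconical U x" and s: "s \<in> U"
  shows "denom i k s - denom j k s = denom i m s - denom j m s"
proof (cases "i = j")
  case False
  let ?w = "\<lambda>l k. weight l k (s $ l)"
  define v :: "real^'n" where "v = (\<chi> k. x s $ k * (?w i k * ?w j k))"
  have "v \<bullet> coord_deriv l x s = 0" if l: "l \<notin> {i, j}" for l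
  proof -
    have "v \<bullet> coord_deriv l x s = h l (s $ l) / 2 * moment {l, i, j} s"
      using False l unfolding moment_eq[OF s] inner_vec_def sum_distrib_left
      by (intro sum.cong) (simp_all add: v_def coord_deriv_eq_weight[OF s] power2_eq_square)
    then show ?thesis using moment_triple_zero[OF s False] l by simp
  qed
  from coord_frame_expansion[OF s this] obtain c where
    c: "v = (\<Sum>l\<in>{i, j}. c l *\<^sub>R coord_deriv l x s)" by metis
  define A where "A = c i * (h i (s $ i) / 2)"
  define B where "B = c j * (h j (s $ j) / 2)"
  have w: "?w i k * ?w j k = A * ?w i k + B * ?w j k" for k
  proof -
    have "v $ k = c i * coord_deriv i x s $ k + c j * coord_deriv j x s $ k"
      by (subst c) (simp add: False)
    then have "x s $ k * (?w i k * ?w j k) = x s $ k * (A * ?w i k + B * ?w j k)"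
      by (simp add: v_def A_def B_def coord_deriv_eq_weight[OF s] algebra_simps)
    then show ?thesis using x_nonzero[OF s, of k] by simp
  qed
  have "0 = (\<Sum>k\<in>UNIV. (x s $ k)\<^sup>2 * (?w i k * ?w j k))"
    using moment_pair_zero[OF s False] False by (simp add: moment_eq[OF s])
  also have "\<dots> = A * moment {i} s + B * moment {j} s"
    by (simp add: w moment_eq[OF s] sum_distrib_left flip: sum.distrib) (simp add: algebra_simps)
  finally have AB: "A * moment {i} s = - B * moment {j} s" by simp
  have eq: "B * (denom i k s - denom j k s) = moment {i} s" for k
  proof -
    have nz: "?w i k \<noteq> 0" "?w j k \<noteq> 0" using s by (simp_all add: weight_nonzero)
    have "moment {i} s * (?w i k * ?w j k)
        = A * moment {i} s * ?w i k + B * moment {i} s * ?w j k"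
      unfolding w by (simp add: algebra_simps)
    also have "\<dots> = B * (moment {i} s * ?w j k - moment {j} s * ?w i k)"
      unfolding AB by (simp add: algebra_simps)
    finally show ?thesis
      using nz by (simp add: denom_def field_simps)
  qed
  then have "B * (denom i k s - denom j k s) = B * (denom i m s - denom j m s)"
    by (simp only:)
  moreover have "B \<noteq> 0" using eq[of k] moment_single_nonzero[OF nc s, of i] by auto
  ultimately show ?thesis by simp
qed simp

text \<open>Up to the constant factor \<open>moment {i} s\<close>, the denominator is \<open>(f i k)\<^sup>2 / \<alpha> i k\<close>, whose
  derivative is \<open>h i\<close> for every \<open>k\<close>; so changing \<open>s\<close> shifts all components equally.\<close>

lemma denom_diff_same_index:
  assumes s: "s \<in> U" and s': "s' \<in> U"
  shows "denom i k s - denom i k s' = denom i m s - denom i m s'"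
proof -
  define q where "q k t = (f i k t)\<^sup>2 / \<alpha> i k" for k t
  have "(\<lambda>t. q k t - q m t) constant_on coord_range i"
  proof (rule has_field_derivative_0_imp_constant_on[OF _ connected_coord_range open_coord_range])
    fix t assume t: "t \<in> coord_range i"
    have "(q k has_real_derivative h i t) (at t)" for k
      unfolding q_def[abs_def]
      using DERIV_cdivide[OF has_sq_deriv[OF t, of k], of "\<alpha> i k"]
      by (simp add: sq_deriv_eq[OF t] slope_nonzero)
    from DERIV_diff[OF this[of k] this[of m]]
    show "((\<lambda>t. q k t - q m t) has_real_derivative 0) (at t)" by simp
  qed
  then have q: "q k (s $ i) - q m (s $ i) = q k (s' $ i) - q m (s' $ i)"
    using s s' by (auto simp: constant_on_def)
  have d: "denom i k s = moment {i} s * q k (s $ i)" for s k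
    by (simp add: denom_def weight_def q_def)
  have "denom i k s - denom i m s = denom i k s' - denom i m s'"
    using q moment_single_constant[OF s s', of i] by (simp add: d flip: right_diff_distrib)
  then show ?thesis by simp
qed

lemma hypersurfaces_confocal:
  assumes nc: "nonconical U x"
  shows "coordinate_hypersurfaces_confocal U x"
proof -
  obtain s0 where s0: "s0 \<in> U" using nonempty_U by blast
  obtain m :: 'n where True by simp
  \<comment> \<open>Any one hypersurface can serve as the member \<open>\<lambda> = 0\<close> of the family.\<close>
  define a :: "real^'n" where "a = (\<chi> k. denom m k s0)"
  have "\<exists>l. (\<forall>k. l + a $ k \<noteq> 0) \<and> coordinate_hypersurface U x i c \<subseteq> confocal_quadric a l" for i c
  proof (cases "c \<in> coord_range i")
    case True
    then obtain s where s: "s \<in> U" and c: "c = s $ i" by auto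
    define l where "l = denom i m s - a $ m"
    have l: "l + a $ k = denom i k s" for k
      using denom_diff_same_point[OF nc s, of i k m m] denom_diff_same_index[OF s s0, of m k m]
      by (simp add: l_def a_def)
    have "denom i k s \<noteq> 0" for k
      using moment_single_nonzero[OF nc s] s by (simp add: denom_def weight_nonzero)
    moreover have "x s' \<in> confocal_quadric a l" if s': "s' \<in> U" and "s' $ i = c" for s'
    proof -
      have "denom i k s = denom i k s'" for k
        using that c moment_single_constant[OF s s', of i] by (simp add: denom_def)
      then show ?thesis
        using sum_squares_over_denom[OF nc s', of i] by (simp add: confocal_quadric_def l)
    qed
    ultimately show ?thesis
      by (intro exI[of _ l]) (auto simp: l coordinate_hypersurface_def)
  next
    case False
    \<comment> \<open>No point of \<open>U\<close> has this coordinate value, so any parameter off the poles will do.\<close>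
    then have "coordinate_hypersurface U x i c = {}"
      by (auto simp: coordinate_hypersurface_def)
    moreover obtain l where "l \<notin> (\<lambda>k. - a $ k) ` UNIV"
      using ex_new_if_finite[OF infinite_UNIV_char_0, of "(\<lambda>k. - a $ k) ` UNIV"] by auto
    ultimately show ?thesis
      by (intro exI[of _ l]) (auto simp: image_iff eq_neg_iff_add_eq_0)
  qed
  then show ?thesis unfolding coordinate_hypersurfaces_confocal_def by blast
qed

end

theorem theorem3p1:
  fixes U :: "(real^'n::finite) set"
    and x :: "real^'n \<Rightarrow> real^'n"
    and f :: "'n \<Rightarrow> 'n \<Rightarrow> real \<Rightarrow> real"
  assumes "coordinate_system U x"
    and "connected U"
    and "nonconical U x"
    and "factorizes_on U x f"
    and "orthogonal_system U x"
  shows "coordinate_hypersurfaces_confocal U x"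
proof -
  have "U \<noteq> {}" using assms(3) by (auto simp: nonconical_def)
  then interpret factorized_orthogonal_system U x f
    using assms by unfold_locales
  obtain \<alpha> h where "\<And>i k. \<alpha> i k \<noteq> 0" and "\<And>i t. t \<in> coord_range i \<Longrightarrow> h i t \<noteq> 0"
    and "\<And>i k t. t \<in> coord_range i \<Longrightarrow> sq_deriv i k t = \<alpha> i k * h i t"
    using sq_deriv_splits by blast
  then interpret straightened_system U x f \<alpha> h
    by unfold_locales
  show ?thesis using hypersurfaces_confocal[OF assms(3)] .
qed

end
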